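(* Let $X \xrightarrow{f} Z \xleftarrow{g} Y$ and $X' \xrightarrow{f'} Z' \xleftarrow{g'} Y'$ be continuous maps between nonempty spaces. Then $$\max\{\mathrm{TC}(f,g),\,\mathrm{TC}(f',g')\}\ \le\ \mathrm{TC}(f\times f',\,g\times g'),$$ where $f\times f'\colon X\times X'\to Z\times Z'$ and $g\times g'\colon Y\times Y'\to Z\times Z'$ are the product maps.
   Context: All maps are continuous, $I=[0,1]$, and path spaces $X^I$ carry the compact-open topology. For a map $p\colon E\to B$, the sectional number $\mathrm{sec}(p)$ is the least integer $k\ge 0$ such that $B$ has an open cover $U_0,\dots,U_k$ with continuous maps $s_i\colon U_i\to E$ satisfying $p\circ s_i=\mathrm{inc}_{U_i}$ (strict equality); $\mathrm{sec}(p)=\infty$ if no such $k$ exists. For maps $f\colon X\to Z$, $g\colon Y\to Z$ put $\Delta^I_{f,g}=\{(\alpha,\beta)\in X^I\times Y^I : f\circ\alpha=g\circ\beta\}$ and $\pi_{f,g}\colon\Delta^I_{f,g}\to X\times Y$, $\pi_{f,g}(\alpha,\beta)=(\alpha(0),\beta(1))$. The bivariate topological complexity is $\mathrm{TC}(f,g):=\mathrm{sec}(\pi_{f,g})$. *)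

theory Defs
  imports "HOL-Analysis.Analysis" "HOL-Library.Extended_Nat"
begin

text \<open>The points of the mapping space are the continuous maps normalised to be
  \<^const>\<open>undefined\<close> outside \<^term>\<open>topspace T\<close>, so that equal maps are equal functions.
  The choice \<open>K = {}\<close> puts the whole mapping space into the subbasis.\<close>

definition compact_open_topology :: "'a topology \<Rightarrow> 'b topology \<Rightarrow> ('a \<Rightarrow> 'b) topology" where
  "compact_open_topology T X =
     (let C = {h \<in> extensional (topspace T). continuous_map T X h}
      in topology_generated_by
           {{h \<in> C. h ` K \<subseteq> U} | K U. compactin T K \<and> openin X U})"

lemma topspace_compact_open_topology:
  "topspace (compact_open_topology T X) =
     {h \<in> extensional (topspace T). continuous_map T X h}" (is "_ = ?C")
proof -
  have "?C \<in> {{h \<in> ?C. h ` K \<subseteq> U} | K U. compactin T K \<and> openin X U}"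
    by (rule CollectI, rule exI[of _ "{}"], rule exI[of _ "{}"]) auto
  then have "\<Union>{{h \<in> ?C. h ` K \<subseteq> U} | K U. compactin T K \<and> openin X U} = ?C"
    by (intro antisym Sup_least Sup_upper) auto
  then show ?thesis
    by (simp add: compact_open_topology_def Let_def topology_generated_by_topspace)
qed

definition path_space :: "'a topology \<Rightarrow> (real \<Rightarrow> 'a) topology" where
  "path_space X = compact_open_topology (top_of_set {0..1}) X"

definition has_sections :: "'e topology \<Rightarrow> 'b topology \<Rightarrow> ('e \<Rightarrow> 'b) \<Rightarrow> nat \<Rightarrow> bool" where
  "has_sections E B p k \<longleftrightarrow>
     (\<exists>U s. (\<forall>i\<le>k. openin B (U i)) \<and> (\<Union>i\<le>k. U i) = topspace B \<and>
            (\<forall>i\<le>k. continuous_map (subtopology B (U i)) E (s i) \<and> (\<forall>b\<in>U i. p (s i b) = b)))"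

text \<open>In \<^typ>\<open>enat\<close> the infimum of the empty set is \<open>\<infinity>\<close>.\<close>

definition sec :: "'e topology \<Rightarrow> 'b topology \<Rightarrow> ('e \<Rightarrow> 'b) \<Rightarrow> enat" where
  "sec E B p = Inf {enat k | k. has_sections E B p k}"

definition path_pullback ::
    "'x topology \<Rightarrow> 'y topology \<Rightarrow> ('x \<Rightarrow> 'z) \<Rightarrow> ('y \<Rightarrow> 'z) \<Rightarrow> ((real \<Rightarrow> 'x) \<times> (real \<Rightarrow> 'y)) topology" where
  "path_pullback X Y f g =
     subtopology (prod_topology (path_space X) (path_space Y))
       {(\<alpha>, \<beta>). \<forall>t\<in>{0..1}. f (\<alpha> t) = g (\<beta> t)}"

definition endpoint_map :: "(real \<Rightarrow> 'x) \<times> (real \<Rightarrow> 'y) \<Rightarrow> 'x \<times> 'y" where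
  "endpoint_map = (\<lambda>(\<alpha>, \<beta>). (\<alpha> 0, \<beta> 1))"

text \<open>The common codomain \<open>Z\<close> of \<^term>\<open>f\<close> and \<^term>\<open>g\<close> enters only through the continuity of
  \<^term>\<open>f\<close> and \<^term>\<open>g\<close>, hence it is not an argument.\<close>

definition TC :: "'x topology \<Rightarrow> 'y topology \<Rightarrow> ('x \<Rightarrow> 'z) \<Rightarrow> ('y \<Rightarrow> 'z) \<Rightarrow> enat" where
  "TC X Y f g = sec (path_pullback X Y f g) (prod_topology X Y) endpoint_map"

lemma continuous_map_path_space_eval:
  assumes "t \<in> {0..1}"
  shows "continuous_map (path_space X) X (\<lambda>\<alpha>. \<alpha> t)"
proof (unfold continuous_map_def, intro conjI allI impI)
  show "(\<lambda>\<alpha>. \<alpha> t) \<in> topspace (path_space X) \<rightarrow> topspace X"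
    using assms by (auto simp: path_space_def topspace_compact_open_topology continuous_map_def)
next
  fix U assume U: "openin X U"
  let ?T = "top_of_set {0..1::real}"
  let ?C = "{h \<in> extensional (topspace ?T). continuous_map ?T X h}"
  have "compactin ?T {t}" using assms by simp
  then have "openin (path_space X) {h \<in> ?C. h ` {t} \<subseteq> U}"
    unfolding path_space_def compact_open_topology_def Let_def
    using U by (intro topology_generated_by_Basis) blast
  moreover have "{h \<in> ?C. h ` {t} \<subseteq> U} = {\<alpha> \<in> topspace (path_space X). \<alpha> t \<in> U}"
    by (simp add: path_space_def topspace_compact_open_topology)
  ultimately show "openin (path_space X) {\<alpha> \<in> topspace (path_space X). \<alpha> t \<in> U}"
    by simp
qed

lemma continuous_map_endpoint_map:
  "continuous_map (path_pullback X Y f g) (prod_topology X Y) endpoint_map"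
proof -
  have "continuous_map (prod_topology (path_space X) (path_space Y)) X ((\<lambda>\<alpha>. \<alpha> 0) \<circ> fst)"
    "continuous_map (prod_topology (path_space X) (path_space Y)) Y ((\<lambda>\<beta>. \<beta> 1) \<circ> snd)"
    by (rule continuous_map_compose[OF continuous_map_fst continuous_map_path_space_eval]
        continuous_map_compose[OF continuous_map_snd continuous_map_path_space_eval], simp)+
  then show ?thesis
    unfolding path_pullback_def endpoint_map_def
    by (intro continuous_map_from_subtopology)
      (simp add: continuous_map_pairwise case_prod_unfold comp_def)
qed

end

theory Submission
  imports Defs
begin

text \<open>
  For the bound on \<open>TC(f, g)\<close>, the spaces \<open>X\<close> and \<open>Y\<close> are exhibited as retracts of \<open>X \<times> X'\<close>
  and \<open>Y \<times> Y'\<close>; the other bound is symmetric.  After choosing base points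
  \<open>x\<^sub>0 \<in> X'\<close> and \<open>y\<^sub>0 \<in> Y'\<close>, the slice inclusions \<open>x \<mapsto> (x, x\<^sub>0)\<close> and \<open>y \<mapsto> (y, y\<^sub>0)\<close> are sections of the
  projections \<open>X \<times> X' \<rightarrow> X\<close> and \<open>Y \<times> Y' \<rightarrow> Y\<close>, and the projections carry a pair of paths
  \<open>(\<alpha>, \<beta>)\<close> with \<open>(f \<times> f') \<circ> \<alpha> = (g \<times> g') \<circ> \<beta>\<close> to a pair of paths that is compatible
  with \<open>f\<close> and \<open>g\<close>.  A local section over an open \<open>U\<close> is therefore turned into a local section
  over the preimage of \<open>U\<close> under the slice inclusion, by including, applying the given
  section, and projecting the resulting paths.  The slice inclusions need not be compatible with
  the maps to \<open>Z \<times> Z'\<close>, that is, \<open>f' x\<^sub>0 = g' y\<^sub>0\<close> is not required, since paths are only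
  ever projected.

  This is \<open>sec_mono_retract\<close> for sectional numbers and \<open>TC_mono_retract\<close> for \<^const>\<open>TC\<close>; the
  topological ingredient is that postcomposition with a continuous map is continuous on path spaces
  (\<open>continuous_map_path_space_postcompose\<close>).
\<close>

text \<open>The restriction to the unit interval brings the composite path into the normal form required
  of points of \<^const>\<open>path_space\<close>.\<close>

lemma continuous_map_path_space_postcompose:
  assumes h: "continuous_map X Y h"
  shows "continuous_map (path_space X) (path_space Y) (\<lambda>\<alpha>. restrict (h \<circ> \<alpha>) {0..1})"
    (is "continuous_map _ _ ?H")
proof -
  let ?I = "top_of_set {0..1::real}"
  let ?C = "\<lambda>W. {a \<in> extensional (topspace ?I). continuous_map ?I W a}"
  have H: "?H a \<in> ?C Y" if "a \<in> ?C X" for a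
  proof -
    have "continuous_map ?I Y (h \<circ> a)"
      using that h by (auto intro: continuous_map_compose)
    then have "continuous_map ?I Y (?H a)"
      by (rule continuous_map_eq) simp
    then show ?thesis
      by simp
  qed
  have "continuous_map (path_space X)
      (topology_generated_by {{a \<in> ?C Y. a ` K \<subseteq> U} | K U. compactin ?I K \<and> openin Y U}) ?H"
  proof (rule continuous_on_generated_topo)
    fix S assume "S \<in> {{a \<in> ?C Y. a ` K \<subseteq> U} | K U. compactin ?I K \<and> openin Y U}"
    then obtain K U where S: "S = {a \<in> ?C Y. a ` K \<subseteq> U}"
      and K: "compactin ?I K" and U: "openin Y U"
      by blast
    let ?V = "{x \<in> topspace X. h x \<in> U}"
    have K01: "K \<subseteq> {0..1}"
      using compactin_subset_topspace[OF K] by simp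
    have "openin X ?V"
      using h U by (rule openin_continuous_map_preimage)
    then have "openin (path_space X) {a \<in> ?C X. a ` K \<subseteq> ?V}"
      unfolding path_space_def compact_open_topology_def Let_def
      using K by (intro topology_generated_by_Basis) blast
    moreover have "?H -` S \<inter> topspace (path_space X) = {a \<in> ?C X. a ` K \<subseteq> ?V}"
    proof (intro set_eqI)
      fix a
      have "?H a ` K \<subseteq> U \<longleftrightarrow> a ` K \<subseteq> ?V" if a: "a \<in> ?C X"
      proof -
        have "a t \<in> topspace X \<and> ?H a t = h (a t)" if "t \<in> K" for t
          using a that K01 by (auto simp: continuous_map_def)
        then show ?thesis
          by (auto simp: image_subset_iff)
      qed
      then show "a \<in> ?H -` S \<inter> topspace (path_space X) \<longleftrightarrow> a \<in> {a \<in> ?C X. a ` K \<subseteq> ?V}"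
        using H[of a] unfolding S path_space_def topspace_compact_open_topology by blast
    qed
    ultimately show "openin (path_space X) (?H -` S \<inter> topspace (path_space X))"
      by simp
  next
    have "?C Y \<in> {{a \<in> ?C Y. a ` K \<subseteq> U} | K U. compactin ?I K \<and> openin Y U}"
      by (rule CollectI, rule exI[of _ "{}"], rule exI[of _ "{}"]) auto
    moreover have "?H ` topspace (path_space X) \<subseteq> ?C Y"
      using H unfolding path_space_def topspace_compact_open_topology by blast
    ultimately show "?H ` topspace (path_space X)
        \<subseteq> \<Union> {{a \<in> ?C Y. a ` K \<subseteq> U} | K U. compactin ?I K \<and> openin Y U}"
      by blast
  qed
  then show ?thesis
    unfolding path_space_def compact_open_topology_def[of _ Y] Let_def .
qed

text \<open>No continuity of \<open>r\<close> is needed, because only \<open>\<psi>\<close> and \<open>\<phi>\<close> enter the construction of the new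
  sections.\<close>

lemma has_sections_retract:
  assumes \<phi>: "continuous_map B' B \<phi>" and \<psi>: "continuous_map E E' \<psi>"
    and comm: "\<And>e. e \<in> topspace E \<Longrightarrow> p' (\<psi> e) = r (p e)"
    and retr: "\<And>b. b \<in> topspace B' \<Longrightarrow> r (\<phi> b) = b"
    and sections: "has_sections E B p k"
  shows "has_sections E' B' p' k"
proof -
  obtain U s where "\<forall>i\<le>k. openin B (U i)" and cover: "(\<Union>i\<le>k. U i) = topspace B"
    and "\<forall>i\<le>k. continuous_map (subtopology B (U i)) E (s i) \<and> (\<forall>b\<in>U i. p (s i b) = b)"
    using sections unfolding has_sections_def by (elim exE conjE)
  then have U: "openin B (U i)"
    and s: "continuous_map (subtopology B (U i)) E (s i)"
    and ps: "\<And>b. b \<in> U i \<Longrightarrow> p (s i b) = b" if "i \<le> k" for i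
    using that by simp_all
  define V where "V i = {b \<in> topspace B'. \<phi> b \<in> U i}" for i
  define t where "t i = \<psi> \<circ> (s i \<circ> \<phi>)" for i
  have "openin B' (V i)" if "i \<le> k" for i
    unfolding V_def using \<phi> U[OF that] by (rule openin_continuous_map_preimage)
  moreover have "(\<Union>i\<le>k. V i) = topspace B'"
  proof -
    have "\<phi> b \<in> (\<Union>i\<le>k. U i)" if "b \<in> topspace B'" for b
      using \<phi> that unfolding cover by (auto simp: continuous_map_def)
    then show ?thesis
      by (auto simp: V_def)
  qed
  moreover have "continuous_map (subtopology B' (V i)) E' (t i)" if "i \<le> k" for i
  proof -
    have "continuous_map (subtopology B' (V i)) (subtopology B (U i)) \<phi>"
      using \<phi> by (auto simp: continuous_map_in_subtopology continuous_map_from_subtopology V_def)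
    then show ?thesis
      unfolding t_def using s[OF that] \<psi> by (blast intro: continuous_map_compose)
  qed
  moreover have "p' (t i b) = b" if i: "i \<le> k" and b: "b \<in> V i" for i b
  proof -
    have b': "b \<in> topspace B'" "\<phi> b \<in> U i"
      using b by (auto simp: V_def)
    then have "\<phi> b \<in> topspace (subtopology B (U i))"
      using openin_subset[OF U[OF i]] by auto
    then have "s i (\<phi> b) \<in> topspace E"
      using s[OF i] by (auto simp: continuous_map_def)
    then show ?thesis
      using comm ps[OF i b'(2)] retr[OF b'(1)] by (simp add: t_def)
  qed
  ultimately show ?thesis
    unfolding has_sections_def by (intro exI[of _ V] exI[of _ t]) simp
qed

lemma sec_mono_retract:
  assumes "continuous_map B' B \<phi>" and "continuous_map E E' \<psi>"
    and "\<And>e. e \<in> topspace E \<Longrightarrow> p' (\<psi> e) = r (p e)"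
    and "\<And>b. b \<in> topspace B' \<Longrightarrow> r (\<phi> b) = b"
  shows "sec E' B' p' \<le> sec E B p"
  unfolding sec_def
  by (rule Inf_superset_mono) (use has_sections_retract[of B' B \<phi> E E' \<psi> p' r p] assms in blast)

text \<open>Compatibility with the maps to the common codomains is required of the retractions \<open>q\<close> and \<open>r\<close>
  only, not of the inclusions \<open>i\<close> and \<open>j\<close>.\<close>

lemma TC_mono_retract:
  assumes i: "continuous_map X' X i" and j: "continuous_map Y' Y j"
    and q: "continuous_map X X' q" and r: "continuous_map Y Y' r"
    and qi: "\<And>x. x \<in> topspace X' \<Longrightarrow> q (i x) = x"
    and rj: "\<And>y. y \<in> topspace Y' \<Longrightarrow> r (j y) = y"
    and compat: "\<And>x y. x \<in> topspace X \<Longrightarrow> y \<in> topspace Y \<Longrightarrow> f x = g y \<Longrightarrow> f' (q x) = g' (r y)"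
  shows "TC X' Y' f' g' \<le> TC X Y f g"
proof -
  let ?Q = "\<lambda>\<alpha>. restrict (q \<circ> \<alpha>) {0..1::real}" and ?R = "\<lambda>\<beta>. restrict (r \<circ> \<beta>) {0..1::real}"
  let ?P = "prod_topology (path_space X) (path_space Y)"
  have "continuous_map ?P (prod_topology (path_space X') (path_space Y')) (map_prod ?Q ?R)"
    unfolding map_prod_def continuous_map_prod_top
    using continuous_map_path_space_postcompose[OF q] continuous_map_path_space_postcompose[OF r]
    by blast
  moreover have "f' (?Q \<alpha> t) = g' (?R \<beta> t)"
    if "\<alpha> \<in> topspace (path_space X)" "\<beta> \<in> topspace (path_space Y)" "t \<in> {0..1}"
      "f (\<alpha> t) = g (\<beta> t)" for \<alpha> \<beta> t
    using that compat[of "\<alpha> t" "\<beta> t"]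
    by (auto simp: path_space_def topspace_compact_open_topology continuous_map_def Pi_iff)
  ultimately have "continuous_map (path_pullback X Y f g) (path_pullback X' Y' f' g') (map_prod ?Q ?R)"
    unfolding path_pullback_def continuous_map_in_subtopology
    by (auto intro!: continuous_map_from_subtopology simp del: restrict_apply)
  moreover have "continuous_map (prod_topology X' Y') (prod_topology X Y) (map_prod i j)"
    unfolding map_prod_def continuous_map_prod_top using i j by blast
  ultimately show ?thesis
    unfolding TC_def
    by (intro sec_mono_retract[where r = "map_prod q r"])
      (auto simp: endpoint_map_def qi rj)
qed

theorem proposition2p19:
  fixes X :: "'x topology" and Y :: "'y topology" and Z :: "'z topology"
    and X' :: "'u topology" and Y' :: "'v topology" and Z' :: "'w topology"
    and f :: "'x \<Rightarrow> 'z" and g :: "'y \<Rightarrow> 'z" and f' :: "'u \<Rightarrow> 'w" and g' :: "'v \<Rightarrow> 'w"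
  assumes "topspace X \<noteq> {}" and "topspace Y \<noteq> {}" and "topspace Z \<noteq> {}"
    and "topspace X' \<noteq> {}" and "topspace Y' \<noteq> {}" and "topspace Z' \<noteq> {}"
    and "continuous_map X Z f" and "continuous_map Y Z g"
    and "continuous_map X' Z' f'" and "continuous_map Y' Z' g'"
  shows "max (TC X Y f g) (TC X' Y' f' g')
           \<le> TC (prod_topology X X') (prod_topology Y Y') (map_prod f f') (map_prod g g')"
proof -
  obtain x y x' y' where "x \<in> topspace X" "y \<in> topspace Y" "x' \<in> topspace X'" "y' \<in> topspace Y'"
    using assms by blast
  then have slices:
    "continuous_map X (prod_topology X X') (\<lambda>a. (a, x'))"
    "continuous_map Y (prod_topology Y Y') (\<lambda>b. (b, y'))"
    "continuous_map X' (prod_topology X X') (\<lambda>a. (x, a))"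
    "continuous_map Y' (prod_topology Y Y') (\<lambda>b. (y, b))"
    by (simp_all add: continuous_map_paired)
  have "TC X Y f g \<le> TC (prod_topology X X') (prod_topology Y Y') (map_prod f f') (map_prod g g')"
    by (rule TC_mono_retract[OF slices(1,2) continuous_map_fst continuous_map_fst]) auto
  moreover have "TC X' Y' f' g'
      \<le> TC (prod_topology X X') (prod_topology Y Y') (map_prod f f') (map_prod g g')"
    by (rule TC_mono_retract[OF slices(3,4) continuous_map_snd continuous_map_snd]) auto
  ultimately show ?thesis
    by (rule max.boundedI)
qed

end
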